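(* The reproducing kernel of $S_1^2(\mathbb{D})$ is $$K_w(z)=\frac{2}{(\overline{w}z)^{2}}\left[\overline{w}z+(\overline{w}z-1)\ln\frac{1}{1-\overline{w}z}\right],\qquad z,w\in\mathbb{D},$$ where for $\overline{w}z=0$ the right-hand side is understood as $1$ (the removable singularity). That is, $K_w\in S_1^2(\mathbb{D})$ and $\langle f,K_w\rangle_{S_1^2}=f(w)$ for every $f\in S_1^2(\mathbb{D})$ and $w\in\mathbb{D}$.
   Context: $\mathbb{D}$ is the open unit disk and $H(\mathbb{D})$ the space of analytic functions on $\mathbb{D}$; for $f\in H(\mathbb{D})$ write $f(z)=\sum_{n\ge 0}f_nz^n$. The derivative Hardy space is the Hilbert space $S_1^2(\mathbb{D})=\{f\in H(\mathbb{D}):\|f\|_{S_1^2}^2=\sum_{n\ge0}\frac{(n+1)(n+2)}{2}|f_n|^2<\infty\}$, with inner product $\langle f,g\rangle_{S_1^2}=\sum_{n\ge0}\frac{(n+1)(n+2)}{2}f_n\overline{g_n}$. $\ln$ is the principal branch. *)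

theory Defs
  imports "HOL-Complex_Analysis.Complex_Analysis"
begin

definition tcoeff :: "(complex \<Rightarrow> complex) \<Rightarrow> nat \<Rightarrow> complex" where
  "tcoeff f n = fps_nth (fps_expansion f 0) n"

definition S12_weight :: "nat \<Rightarrow> real" where
  "S12_weight n = real ((n + 1) * (n + 2)) / 2"

text \<open>Analytic functions on the unit disk are represented by total functions on the complex plane;
  their values outside the disk are irrelevant.\<close>

definition S12 :: "(complex \<Rightarrow> complex) set" where
  "S12 = {f. f holomorphic_on ball 0 1 \<and>
             summable (\<lambda>n. S12_weight n * (cmod (tcoeff f n))\<^sup>2)}"

text \<open>For \<open>f\<close>, \<open>g\<close> in \<open>S12\<close> the series converges absolutely by the Cauchy-Schwarz inequality.\<close>

definition S12_inner :: "(complex \<Rightarrow> complex) \<Rightarrow> (complex \<Rightarrow> complex) \<Rightarrow> complex" where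
  "S12_inner f g = (\<Sum>n. complex_of_real (S12_weight n) * tcoeff f n * cnj (tcoeff g n))"

text \<open>On complex arguments \<open>ln\<close> is the principal branch; for \<open>z\<close>, \<open>w\<close> in the unit disk its
  argument here has positive real part.\<close>

definition S12_kernel :: "complex \<Rightarrow> complex \<Rightarrow> complex" where
  "S12_kernel w z =
     (if cnj w * z = 0 then 1
      else 2 / (cnj w * z)\<^sup>2 *
             (cnj w * z + (cnj w * z - 1) * ln (1 / (1 - cnj w * z))))"

definition reproducing_kernel_S12 :: "(complex \<Rightarrow> complex \<Rightarrow> complex) \<Rightarrow> bool" where
  "reproducing_kernel_S12 K \<longleftrightarrow>
     (\<forall>w\<in>ball 0 1. K w \<in> S12 \<and> (\<forall>f\<in>S12. S12_inner f (K w) = f w))"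

end

theory Submission
  imports Defs
begin

text \<open>
  The monomials are orthogonal in the space, with squared norms given by the weights
  \<open>(n + 1) * (n + 2) / 2\<close>. A function with Taylor coefficients
  \<open>cnj w ^ n / S12_weight n\<close> therefore pairs with \<open>f\<close> to the Taylor series of \<open>f\<close> at \<open>w\<close>,
  because the weights cancel. It remains to sum the kernel series: with \<open>u = cnj w * z\<close>,
  partial fractions turn the coefficient \<open>2 / ((n + 1) * (n + 2))\<close> into a difference of two
  neighbouring terms of the harmonic sequence, so that the sum is a combination of two index
  shifts of the logarithmic series, which is the closed formula (lemma \<open>S12_kernel_sums\<close>).
  As the series converges on the whole disk, its sum is holomorphic there and its coefficients
  are the Taylor coefficients (lemma \<open>powser_sums_ball\<close>); this also settles the removable
  singularity of the closed formula.
\<close>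

lemma S12_weight_ge_1: "1 \<le> S12_weight n"
  by (simp add: S12_weight_def)

lemma S12_weight_pos: "0 < S12_weight n"
  using S12_weight_ge_1[of n] by linarith

lemma holomorphic_tcoeff_sums:
  assumes "f holomorphic_on ball 0 1" "cmod w < 1"
  shows "(\<lambda>n. tcoeff f n * w ^ n) sums f w"
  using holomorphic_power_series[of f 0 1 w] assms
  by (simp add: tcoeff_def fps_expansion_def)

text \<open>Convergence at every real point of \<open>(0, 1)\<close> forces a radius of convergence of at
  least 1, so \<open>f\<close> is the evaluation of a formal power series near 0, and such an expansion is
  unique. For the kernel this replaces any differentiation of the closed formula.\<close>

lemma powser_sums_ball:
  assumes sums: "\<And>z. cmod z < 1 \<Longrightarrow> (\<lambda>n. a n * z ^ n) sums f z"
  shows "f holomorphic_on ball 0 1" and "tcoeff f n = a n"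
proof -
  show hol: "f holomorphic_on ball 0 1"
    by (rule power_series_holomorphic[where a = a]) (use sums in auto)
  have rad: "fps_conv_radius (Abs_fps a) \<ge> 1"
    unfolding fps_conv_radius_def
  proof (rule conv_radius_geI_ex)
    fix r :: real assume "0 < r" "ereal r < 1"
    then show "\<exists>z. norm z = r \<and> summable (\<lambda>n. fps_nth (Abs_fps a) n * z ^ n)"
      using sums[of "of_real r"] by (intro exI[of _ "of_real r"]) (auto simp: sums_iff)
  qed
  have "f has_fps_expansion Abs_fps a"
    unfolding has_fps_expansion_def
  proof
    show "0 < fps_conv_radius (Abs_fps a)"
      using rad by (rule less_le_trans[rotated]) simp
    have "eventually (\<lambda>z. z \<in> ball (0::complex) 1) (nhds 0)"
      by (intro eventually_nhds_in_open) auto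
    then show "\<forall>\<^sub>F z in nhds 0. eval_fps (Abs_fps a) z = f z"
      by eventually_elim (use sums in \<open>simp add: eval_fps_def sums_iff\<close>)
  qed
  then show "tcoeff f n = a n"
    by (simp add: tcoeff_def fps_expansion_eqI)
qed

text \<open>Partial fractions, \<open>1 / ((n + 1) * (n + 2)) = 1 / (n + 1) - 1 / (n + 2)\<close>, write
  \<open>u\<^sup>2\<close> times half of the series as \<open>u * L - (L - u)\<close>, where
  \<open>L = ln (1 / (1 - u))\<close> is the sum of \<open>u ^ k / k\<close> over \<open>k \<ge> 1\<close>.\<close>

lemma ln_inverse_weight_sums:
  assumes "cmod u < 1" "u \<noteq> 0"
  shows "(\<lambda>n. u ^ n / of_real (S12_weight n)) sums
           (2 / u\<^sup>2 * (u + (u - 1) * ln (1 / (1 - u))))"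
proof -
  define L where "L = ln (1 / (1 - u))"
  \<comment> \<open>\<open>1 - u\<close> has positive real part and so avoids the branch cut.\<close>
  have "Re u < 1"
    using complex_Re_le_cmod[of u] assms by linarith
  then have "1 - u \<notin> \<real>\<^sub>\<le>\<^sub>0"
    by (auto simp: complex_nonpos_Reals_iff)
  then have "L = - ln (1 - u)"
    by (simp add: L_def Ln_inverse flip: inverse_eq_divide)
  then have L0: "(\<lambda>n. u ^ n / of_nat n) sums L"
    using sums_minus[OF Ln_series'[of "- u"]] assms by simp
  have L1: "(\<lambda>n. u ^ (n + 1) / of_nat (n + 1)) sums L"
    using sums_split_initial_segment[OF L0, of 1] by simp
  have L2: "(\<lambda>n. u ^ (n + 2) / of_nat (n + 2)) sums (L - u)"
    using sums_split_initial_segment[OF L0, of 2] by (simp add: numeral_2_eq_2)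
  have "(\<lambda>n. 2 / u\<^sup>2 * (u * (u ^ (n + 1) / of_nat (n + 1)) - u ^ (n + 2) / of_nat (n + 2)))
          sums (2 / u\<^sup>2 * (u * L - (L - u)))"
    by (intro sums_mult sums_diff L1 L2)
  moreover have "2 / u\<^sup>2 * (u * (u ^ (n + 1) / of_nat (n + 1)) - u ^ (n + 2) / of_nat (n + 2))
      = u ^ n / of_real (S12_weight n)" for n
  proof -
    have "(1 + of_nat n :: complex) \<noteq> 0" "(2 + of_nat n :: complex) \<noteq> 0"
      by (metis of_nat_Suc of_nat_eq_0_iff nat.distinct(1),
          metis of_nat_Suc of_nat_eq_0_iff nat.distinct(1) add_2_eq_Suc of_nat_add of_nat_numeral)
    then show ?thesis
      using assms(2) by (simp add: S12_weight_def field_simps power2_eq_square)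
  qed
  ultimately show ?thesis
    by (simp add: L_def algebra_simps)
qed

lemma S12_kernel_sums:
  assumes "cmod w < 1" "cmod z < 1"
  shows "(\<lambda>n. cnj w ^ n / of_real (S12_weight n) * z ^ n) sums S12_kernel w z"
proof (cases "cnj w * z = 0")
  case True
  have "(\<lambda>n. cnj w ^ n / of_real (S12_weight n) * z ^ n) = (\<lambda>n. if n = 0 then 1 else 0)"
    using True by (auto simp: fun_eq_iff S12_weight_def power_0_left)
  then show ?thesis
    using True sums_single[of 0 "\<lambda>_. 1::complex"] by (simp add: S12_kernel_def)
next
  case False
  have "cmod (cnj w * z) < 1"
    using assms mult_strict_mono[of "cmod w" 1 "cmod z" 1] by (simp add: norm_mult)
  from ln_inverse_weight_sums[OF this False] show ?thesis
    using False by (simp add: S12_kernel_def power_mult_distrib)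
qed

lemma holomorphic_S12_kernel:
  assumes "cmod w < 1"
  shows "S12_kernel w holomorphic_on ball 0 1"
  using powser_sums_ball(1) S12_kernel_sums[OF assms] .

lemma tcoeff_S12_kernel:
  assumes "cmod w < 1"
  shows "tcoeff (S12_kernel w) n = cnj w ^ n / of_real (S12_weight n)"
  using powser_sums_ball(2) S12_kernel_sums[OF assms] .

text \<open>The \<open>n\<close>-th term of the squared norm of the kernel is \<open>\<bar>w\<bar> ^ (2 * n) / S12_weight n\<close>,
  and the weights are at least 1, so a geometric series dominates.\<close>

lemma S12_kernel_in_S12:
  assumes "cmod w < 1"
  shows "S12_kernel w \<in> S12"
proof -
  have "summable (\<lambda>n. S12_weight n * (cmod (tcoeff (S12_kernel w) n))\<^sup>2)"
  proof (rule summable_comparison_test')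
    show "summable (\<lambda>n. ((cmod w)\<^sup>2) ^ n)"
      using assms by (simp add: summable_geometric abs_square_less_1)
    fix n :: nat
    have "S12_weight n * (cmod (tcoeff (S12_kernel w) n))\<^sup>2 = ((cmod w)\<^sup>2) ^ n / S12_weight n"
      using S12_weight_pos[of n] assms
      by (simp add: tcoeff_S12_kernel norm_divide norm_power power_divide power2_eq_square
          power_mult_distrib)
    also have "\<dots> \<le> ((cmod w)\<^sup>2) ^ n"
      using S12_weight_ge_1[of n] by (simp add: divide_le_eq mult_le_cancel_left1)
    finally show "norm (S12_weight n * (cmod (tcoeff (S12_kernel w) n))\<^sup>2) \<le> ((cmod w)\<^sup>2) ^ n"
      using S12_weight_pos[of n] by simp
  qed
  then show ?thesis
    by (simp add: S12_def holomorphic_S12_kernel assms)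
qed

lemma S12_inner_kernel:
  assumes "f holomorphic_on ball 0 1" "cmod w < 1"
  shows "S12_inner f (S12_kernel w) = f w"
proof -
  have *: "of_real (S12_weight n) * tcoeff f n * cnj (tcoeff (S12_kernel w) n)
      = tcoeff f n * w ^ n" for n
    using S12_weight_pos[of n] assms(2) by (simp add: tcoeff_S12_kernel)
  show ?thesis
    unfolding S12_inner_def * using holomorphic_tcoeff_sums[OF assms] by (rule sums_unique[symmetric])
qed

theorem lemma1p1:
  shows "reproducing_kernel_S12 S12_kernel"
  unfolding reproducing_kernel_S12_def
proof (intro ballI conjI)
  fix w :: complex assume "w \<in> ball 0 1"
  then have w: "cmod w < 1" by simp
  then show "S12_kernel w \<in> S12" by (rule S12_kernel_in_S12)
  fix f assume "f \<in> S12"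
  then show "S12_inner f (S12_kernel w) = f w"
    using w by (intro S12_inner_kernel) (auto simp: S12_def)
qed

end
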